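(* For ELPs the following hold, where "$A$ is strictly stronger than $B$" means that every pair of ELPs satisfying $A$ satisfies $B$, and there is a pair of ELPs satisfying $B$ but not $A$: (1) strong equivalence is strictly stronger than uniform CWV-equivalence; (2) uniform CWV-equivalence is strictly stronger than uniform WV-equivalence; (3) uniform CWV-equivalence is strictly stronger than (ordinary) CWV-equivalence; (4) uniform WV-equivalence is strictly stronger than (ordinary) WV-equivalence.
   Context: Logic programs, GL-reduct and answer sets $AS(\cdot)$ are as usual for disjunctive programs with nested default negation $\neg$. An ELP is a triple $(\mathcal{A},\mathcal{E},\mathcal{R})$: $\mathcal{A}$ atoms, $\mathcal{E}$ a set of epistemic literals $\mathbf{not}\,\ell$ ($\ell$ a literal), $\mathcal{R}$ a finite set of rules $a_1\vee\cdots\vee a_k\leftarrow\ell_1,\dots,\ell_m,\xi_1,\dots,\xi_j,\neg\xi_{j+1},\dots,\neg\xi_n$ with $\xi_i\in\mathcal{E}$. Union is componentwise; a set of facts $D\subseteq\mathcal{A}$ is the ELP $(\mathcal{A},\emptyset,\{a\leftarrow\mid a\in D\})$. When comparing two ELPs they are assumed to have the same $\mathcal{A}$ and $\mathcal{E}$. For a guess $\Phi\subseteq\mathcal{E}$, the epistemic reduct $\Pi^\Phi$ replaces each $\mathbf{not}\,\ell\in\Phi$ by $\top$ and every remaining $\mathbf{not}$ by $\neg$. $\mathcal{I}$ is $\Phi$-compatible w.r.t. $\mathcal{E}$ iff $\mathcal{I}\neq\emptyset$, each $\mathbf{not}\,\ell\in\Phi$ has some $I\in\mathcal{I}$ with $I\not\models\ell$,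 and each $\mathbf{not}\,\ell\in\mathcal{E}\setminus\Phi$ has $I\models\ell$ for all $I\in\mathcal{I}$. A CWV of $\Pi$ is $\mathcal{M}=AS(\Pi^\Phi)$ that is $\Phi$-compatible for some $\Phi$; a WV is a CWV whose guess is subset-maximal among guesses yielding CWVs. Two ELPs are CWV-equivalent (WV-equivalent) iff they have the same CWVs (WVs); uniformly CWV-(WV-)equivalent iff $\Pi_1\cup D$ and $\Pi_2\cup D$ are CWV-(WV-)equivalent for every set of facts $D\subseteq\mathcal{A}$; strongly equivalent iff for every ELP $\Pi$, $\Pi_1\cup\Pi$ and $\Pi_2\cup\Pi$ are CWV-equivalent (equivalently, WV-equivalent). *)

theory Defs
  imports Main
begin

(* Body elements of logic programs: atoms, \<top>, and default negation nested to any depth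
   (the epistemic reduct can produce up to three nested negations). *)
datatype 'a nlit = Top | Atom 'a | Neg "'a nlit"

fun nsat :: "'a set \<Rightarrow> 'a nlit \<Rightarrow> bool" where
  "nsat I Top \<longleftrightarrow> True"
| "nsat I (Atom a) \<longleftrightarrow> a \<in> I"
| "nsat I (Neg b) \<longleftrightarrow> \<not> nsat I b"

record 'a lp_rule =
  lp_head :: "'a set"
  lp_body :: "'a nlit set"

record 'a lp =
  lp_atoms :: "'a set"
  lp_rules :: "'a lp_rule set"

definition rule_sat :: "'a set \<Rightarrow> 'a lp_rule \<Rightarrow> bool" where
  "rule_sat I r \<longleftrightarrow> ((\<forall>b \<in> lp_body r. nsat I b) \<longrightarrow> (\<exists>a \<in> lp_head r. a \<in> I))"

definition lp_models :: "'a lp \<Rightarrow> 'a set set" where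
  "lp_models P = {I. I \<subseteq> lp_atoms P \<and> (\<forall>r \<in> lp_rules P. rule_sat I r)}"

definition positive_body :: "'a lp_rule \<Rightarrow> 'a nlit set" where
  "positive_body r = {Atom a | a. Atom a \<in> lp_body r}"

definition GL_reduct :: "'a lp \<Rightarrow> 'a set \<Rightarrow> 'a lp" where
  "GL_reduct P I =
    \<lparr>lp_atoms = lp_atoms P,
     lp_rules = {\<lparr>lp_head = lp_head r, lp_body = positive_body r\<rparr> | r.
       r \<in> lp_rules P \<and> (\<forall>b. Neg b \<in> lp_body r \<longrightarrow> nsat I (Neg b))}\<rparr>"

definition answer_sets :: "'a lp \<Rightarrow> 'a set set" where
  "answer_sets P =
    {M. M \<in> lp_models P \<and> \<not> (\<exists>M'. M' \<subset> M \<and> M' \<in> lp_models (GL_reduct P M))}"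


datatype 'a literal = PosLit 'a | NegLit 'a

fun lit_atom :: "'a literal \<Rightarrow> 'a" where
  "lit_atom (PosLit a) = a"
| "lit_atom (NegLit a) = a"

fun nlit_of :: "'a literal \<Rightarrow> 'a nlit" where
  "nlit_of (PosLit a) = Atom a"
| "nlit_of (NegLit a) = Neg (Atom a)"

fun lit_sat :: "'a set \<Rightarrow> 'a literal \<Rightarrow> bool" where
  "lit_sat I (PosLit a) \<longleftrightarrow> a \<in> I"
| "lit_sat I (NegLit a) \<longleftrightarrow> a \<notin> I"

datatype 'a epistemic_literal = ENot "'a literal"

fun elit_lit :: "'a epistemic_literal \<Rightarrow> 'a literal" where
  "elit_lit (ENot l) = l"

(* \<open>body_epos\<close> holds the \<xi> occurring unnegated in the body, \<open>body_eneg\<close> the \<xi> occurring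
   as \<not>\<xi>. An empty head is a constraint. *)
record 'a elp_rule =
  head :: "'a set"
  body_lits :: "'a literal set"
  body_epos :: "'a epistemic_literal set"
  body_eneg :: "'a epistemic_literal set"

record 'a elp =
  atoms :: "'a set"
  elits :: "'a epistemic_literal set"
  rules :: "'a elp_rule set"

definition elp_rule_over :: "'a set \<Rightarrow> 'a epistemic_literal set \<Rightarrow> 'a elp_rule \<Rightarrow> bool" where
  "elp_rule_over A E r \<longleftrightarrow>
    finite (head r) \<and> head r \<subseteq> A \<and>
    finite (body_lits r) \<and> lit_atom ` body_lits r \<subseteq> A \<and>
    finite (body_epos r) \<and> body_epos r \<subseteq> E \<and>
    finite (body_eneg r) \<and> body_eneg r \<subseteq> E"

definition is_elp :: "'a elp \<Rightarrow> bool" where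
  "is_elp P \<longleftrightarrow>
    (\<forall>\<xi> \<in> elits P. lit_atom (elit_lit \<xi>) \<in> atoms P) \<and>
    finite (rules P) \<and> (\<forall>r \<in> rules P. elp_rule_over (atoms P) (elits P) r)"

definition elp_union :: "'a elp \<Rightarrow> 'a elp \<Rightarrow> 'a elp" where
  "elp_union P Q =
    \<lparr>atoms = atoms P \<union> atoms Q, elits = elits P \<union> elits Q, rules = rules P \<union> rules Q\<rparr>"

definition facts :: "'a set \<Rightarrow> 'a set \<Rightarrow> 'a elp" where
  "facts A D =
    \<lparr>atoms = A, elits = {},
     rules = {\<lparr>head = {a}, body_lits = {}, body_epos = {}, body_eneg = {}\<rparr> | a. a \<in> D}\<rparr>"

definition reduct_elit :: "'a epistemic_literal set \<Rightarrow> 'a epistemic_literal \<Rightarrow> 'a nlit" where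
  "reduct_elit \<Phi> \<xi> = (if \<xi> \<in> \<Phi> then Top else Neg (nlit_of (elit_lit \<xi>)))"

definition reduct_rule :: "'a epistemic_literal set \<Rightarrow> 'a elp_rule \<Rightarrow> 'a lp_rule" where
  "reduct_rule \<Phi> r =
    \<lparr>lp_head = head r,
     lp_body = nlit_of ` body_lits r \<union> reduct_elit \<Phi> ` body_epos r
       \<union> (\<lambda>\<xi>. Neg (reduct_elit \<Phi> \<xi>)) ` body_eneg r\<rparr>"

definition epistemic_reduct :: "'a elp \<Rightarrow> 'a epistemic_literal set \<Rightarrow> 'a lp" where
  "epistemic_reduct P \<Phi> = \<lparr>lp_atoms = atoms P, lp_rules = reduct_rule \<Phi> ` rules P\<rparr>"

definition compatible ::
  "'a epistemic_literal set \<Rightarrow> 'a epistemic_literal set \<Rightarrow> 'a set set \<Rightarrow> bool" where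
  "compatible \<Phi> E \<I> \<longleftrightarrow>
    \<I> \<noteq> {} \<and>
    (\<forall>\<xi> \<in> \<Phi>. \<exists>I \<in> \<I>. \<not> lit_sat I (elit_lit \<xi>)) \<and>
    (\<forall>\<xi> \<in> E - \<Phi>. \<forall>I \<in> \<I>. lit_sat I (elit_lit \<xi>))"

definition cwv_guess :: "'a elp \<Rightarrow> 'a epistemic_literal set \<Rightarrow> 'a set set \<Rightarrow> bool" where
  "cwv_guess P \<Phi> \<M> \<longleftrightarrow>
    \<Phi> \<subseteq> elits P \<and> \<M> = answer_sets (epistemic_reduct P \<Phi>) \<and> compatible \<Phi> (elits P) \<M>"

definition CWV :: "'a elp \<Rightarrow> 'a set set set" where
  "CWV P = {\<M>. \<exists>\<Phi>. cwv_guess P \<Phi> \<M>}"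

definition WV :: "'a elp \<Rightarrow> 'a set set set" where
  "WV P = {\<M>. \<exists>\<Phi>. cwv_guess P \<Phi> \<M> \<and> \<not> (\<exists>\<Phi>' \<M>'. cwv_guess P \<Phi>' \<M>' \<and> \<Phi> \<subset> \<Phi>')}"


definition CWV_equivalent :: "'a elp \<Rightarrow> 'a elp \<Rightarrow> bool" where
  "CWV_equivalent P Q \<longleftrightarrow> CWV P = CWV Q"

definition WV_equivalent :: "'a elp \<Rightarrow> 'a elp \<Rightarrow> bool" where
  "WV_equivalent P Q \<longleftrightarrow> WV P = WV Q"

(* The equivalence notions are only used for P and Q with the same atoms
   (see \<open>strictly_stronger\<close>), so bounding D by the atoms of P is no loss. *)
definition uniformly_CWV_equivalent :: "'a elp \<Rightarrow> 'a elp \<Rightarrow> bool" where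
  "uniformly_CWV_equivalent P Q \<longleftrightarrow>
    (\<forall>D. D \<subseteq> atoms P \<longrightarrow>
      CWV_equivalent (elp_union P (facts (atoms P) D)) (elp_union Q (facts (atoms P) D)))"

definition uniformly_WV_equivalent :: "'a elp \<Rightarrow> 'a elp \<Rightarrow> bool" where
  "uniformly_WV_equivalent P Q \<longleftrightarrow>
    (\<forall>D. D \<subseteq> atoms P \<longrightarrow>
      WV_equivalent (elp_union P (facts (atoms P) D)) (elp_union Q (facts (atoms P) D)))"

(* The context program R may bring in atoms and epistemic literals of its own. *)
definition strongly_equivalent :: "'a elp \<Rightarrow> 'a elp \<Rightarrow> bool" where
  "strongly_equivalent P Q \<longleftrightarrow>
    (\<forall>R. is_elp R \<longrightarrow> CWV_equivalent (elp_union P R) (elp_union Q R))"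

definition elp_pair :: "'a elp \<Rightarrow> 'a elp \<Rightarrow> bool" where
  "elp_pair P Q \<longleftrightarrow> is_elp P \<and> is_elp Q \<and> atoms P = atoms Q \<and> elits P = elits Q"

definition strictly_stronger ::
  "('a elp \<Rightarrow> 'a elp \<Rightarrow> bool) \<Rightarrow> ('a elp \<Rightarrow> 'a elp \<Rightarrow> bool) \<Rightarrow> bool" where
  "strictly_stronger S T \<longleftrightarrow>
    (\<forall>P Q. elp_pair P Q \<and> S P Q \<longrightarrow> T P Q) \<and>
    (\<exists>P Q. elp_pair P Q \<and> T P Q \<and> \<not> S P Q)"

end

theory Submission
  imports Defs
begin

text \<open>
  The guess of a CWV is determined by the CWV and the set of epistemic literals, so the WVs are
  determined by the CWVs. Hence uniform CWV-equivalence implies uniform WV-equivalence, and uniform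
  equivalence implies ordinary equivalence by adding no facts.

  That strong equivalence implies uniform CWV-equivalence is not immediate, because the set of
  facts \<open>D\<close> may be infinite whereas a context program is finite. But the rules of the two programs
  mention only a finite set \<open>V\<close> of atoms, and the facts outside \<open>V\<close> are merely added to every answer
  set; they only force the guess on epistemic literals that occur in no rule. Thus it
  suffices to use the finite context \<open>D \<inter> V\<close>.

  Strictness is witnessed by
  (1) \<open>{a \<or> b}\<close> and \<open>{a \<leftarrow> \<not>b, b \<leftarrow> \<not>a}\<close>, separated by the context \<open>{a \<leftarrow> b, b \<leftarrow> a}\<close>;
  (2) \<open>{a \<or> b \<leftarrow> not \<not>a, not \<not>b}\<close> and \<open>{a \<or> b}\<close>, where only the former has the CWV \<open>{\<emptyset>}\<close>, which is
  not a WV;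
  (3), (4) the empty program and \<open>{\<leftarrow> a}\<close>, separated by the fact \<open>a\<close>.
\<close>

section \<open>Answer sets of epistemic reducts\<close>

text \<open>Satisfaction by \<open>X\<close> of the GL-reduct with respect to \<open>M\<close> of the epistemic reduct of a rule.\<close>

definition reduct_sat ::
  "'a epistemic_literal set \<Rightarrow> 'a set \<Rightarrow> 'a set \<Rightarrow> 'a elp_rule \<Rightarrow> bool" where
  "reduct_sat \<Phi> M X r \<longleftrightarrow>
    ((\<forall>a. PosLit a \<in> body_lits r \<longrightarrow> a \<in> X) \<and> (\<forall>a. NegLit a \<in> body_lits r \<longrightarrow> a \<notin> M) \<and>
     (\<forall>\<xi> \<in> body_epos r. \<xi> \<in> \<Phi> \<or> \<not> lit_sat M (elit_lit \<xi>)) \<and>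
     (\<forall>\<xi> \<in> body_eneg r. \<xi> \<notin> \<Phi> \<and> lit_sat M (elit_lit \<xi>)) \<longrightarrow>
     head r \<inter> X \<noteq> {})"

lemma nsat_nlit_of [simp]: "nsat I (nlit_of l) \<longleftrightarrow> lit_sat I l"
  by (cases l) auto

lemma nsat_reduct_elit [simp]:
  "nsat I (reduct_elit \<Phi> \<xi>) \<longleftrightarrow> \<xi> \<in> \<Phi> \<or> \<not> lit_sat I (elit_lit \<xi>)"
  by (simp add: reduct_elit_def)

lemma ball_literal:
  "(\<forall>l \<in> L. Q l) \<longleftrightarrow> (\<forall>a. PosLit a \<in> L \<longrightarrow> Q (PosLit a)) \<and> (\<forall>a. NegLit a \<in> L \<longrightarrow> Q (NegLit a))"
  by (metis literal.exhaust)

lemma rule_sat_reduct_rule: "rule_sat M (reduct_rule \<Phi> r) \<longleftrightarrow> reduct_sat \<Phi> M M r"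
  by (auto simp: rule_sat_def reduct_rule_def reduct_sat_def ball_Un ball_literal)

text \<open>An epistemic literal becomes \<open>Top\<close> or something negated under the reduct,
  so the positive body is independent of the guess.\<close>

lemma Atom_in_reduct_body:
  "Atom a \<in> lp_body (reduct_rule \<Phi> r) \<longleftrightarrow> PosLit a \<in> body_lits r"
proof -
  have "Atom a = nlit_of l \<longleftrightarrow> l = PosLit a" for l
    by (cases l) auto
  then show ?thesis
    by (auto simp: reduct_rule_def reduct_elit_def image_iff split: if_splits)
qed

text \<open>A guessed \<xi> turns into \<open>Top\<close>, which imposes no condition in
  \<open>body_epos\<close> but makes \<open>Neg Top\<close> fail in \<open>body_eneg\<close>. An
  unguessed \<xi> leaves one or two negations around its literal, evaluated in
  \<open>M\<close>.\<close>

lemma reduct_body_Neg_sat: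
  "(\<forall>b. Neg b \<in> lp_body (reduct_rule \<Phi> r) \<longrightarrow> nsat M (Neg b)) \<longleftrightarrow>
    (\<forall>a. NegLit a \<in> body_lits r \<longrightarrow> a \<notin> M) \<and>
    (\<forall>\<xi> \<in> body_epos r. \<xi> \<in> \<Phi> \<or> \<not> lit_sat M (elit_lit \<xi>)) \<and>
    (\<forall>\<xi> \<in> body_eneg r. \<xi> \<notin> \<Phi> \<and> lit_sat M (elit_lit \<xi>))"
proof -
  have lits: "Neg b = nlit_of l \<longleftrightarrow> (\<exists>a. l = NegLit a \<and> b = Atom a)" for b :: "'a nlit" and l
    by (cases l) auto
  have epos: "Neg b = reduct_elit \<Phi> \<xi> \<longleftrightarrow> \<xi> \<notin> \<Phi> \<and> b = nlit_of (elit_lit \<xi>)" for b \<xi>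
    by (auto simp: reduct_elit_def)
  have mem: "Neg b \<in> lp_body (reduct_rule \<Phi> r) \<longleftrightarrow>
      (\<exists>a. NegLit a \<in> body_lits r \<and> b = Atom a) \<or>
      (\<exists>\<xi> \<in> body_epos r. \<xi> \<notin> \<Phi> \<and> b = nlit_of (elit_lit \<xi>)) \<or>
      (\<exists>\<xi> \<in> body_eneg r. b = reduct_elit \<Phi> \<xi>)" for b
    unfolding reduct_rule_def lp_rule.simps Un_iff image_iff lits epos nlit.inject by blast
  have "(\<forall>b. Neg b \<in> lp_body (reduct_rule \<Phi> r) \<longrightarrow> nsat M (Neg b)) \<longleftrightarrow>
      (\<forall>a. NegLit a \<in> body_lits r \<longrightarrow> nsat M (Neg (Atom a))) \<and>
      (\<forall>\<xi> \<in> body_epos r. \<xi> \<notin> \<Phi> \<longrightarrow> nsat M (Neg (nlit_of (elit_lit \<xi>)))) \<and>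
      (\<forall>\<xi> \<in> body_eneg r. nsat M (Neg (reduct_elit \<Phi> \<xi>)))"
    unfolding mem by blast
  then show ?thesis
    by auto
qed

text \<open>A rule deleted by the GL-reduct has a negated body part that fails in \<open>M\<close>;
  then \<open>reduct_sat\<close> holds vacuously, so quantifying over all rules of \<open>P\<close>
  is harmless.\<close>

lemma rule_sat_GL_reduct:
  "(\<forall>r' \<in> lp_rules (GL_reduct (epistemic_reduct P \<Phi>) M). rule_sat X r') \<longleftrightarrow>
    (\<forall>r \<in> rules P. reduct_sat \<Phi> M X r)"
proof -
  have "rule_sat X \<lparr>lp_head = lp_head (reduct_rule \<Phi> r),
      lp_body = positive_body (reduct_rule \<Phi> r)\<rparr> \<longleftrightarrow>
    ((\<forall>a. PosLit a \<in> body_lits r \<longrightarrow> a \<in> X) \<longrightarrow> head r \<inter> X \<noteq> {})" for r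
    by (auto simp: rule_sat_def positive_body_def Atom_in_reduct_body)
      (auto simp: reduct_rule_def)
  then have "(rule_sat X \<lparr>lp_head = lp_head (reduct_rule \<Phi> r),
        lp_body = positive_body (reduct_rule \<Phi> r)\<rparr> \<or>
      \<not> (\<forall>b. Neg b \<in> lp_body (reduct_rule \<Phi> r) \<longrightarrow> nsat M (Neg b))) \<longleftrightarrow>
    reduct_sat \<Phi> M X r" for r
    unfolding reduct_body_Neg_sat reduct_sat_def by blast
  then show ?thesis
    unfolding GL_reduct_def epistemic_reduct_def lp.simps by blast
qed

lemma answer_sets_epistemic_reduct:
  "answer_sets (epistemic_reduct P \<Phi>) =
    {M. M \<subseteq> atoms P \<and> (\<forall>r \<in> rules P. reduct_sat \<Phi> M M r) \<and>
      (\<forall>X. X \<subset> M \<longrightarrow> (\<exists>r \<in> rules P. \<not> reduct_sat \<Phi> M X r))}"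
proof -
  have "M \<in> lp_models (epistemic_reduct P \<Phi>) \<longleftrightarrow>
      M \<subseteq> atoms P \<and> (\<forall>r \<in> rules P. reduct_sat \<Phi> M M r)" for M
    by (auto simp: lp_models_def epistemic_reduct_def rule_sat_reduct_rule)
  moreover have "X \<in> lp_models (GL_reduct (epistemic_reduct P \<Phi>) M) \<longleftrightarrow>
      X \<subseteq> atoms P \<and> (\<forall>r \<in> rules P. reduct_sat \<Phi> M X r)" for X M
    unfolding lp_models_def mem_Collect_eq rule_sat_GL_reduct
    by (simp add: GL_reduct_def epistemic_reduct_def)
  moreover have "X \<subset> M \<Longrightarrow> M \<subseteq> atoms P \<Longrightarrow> X \<subseteq> atoms P" for X M
    by blast
  ultimately show ?thesis
    unfolding answer_sets_def by (intro Collect_cong) (simp only:, meson)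
qed

section \<open>Answer sets after adding facts\<close>

abbreviation add_facts :: "'a elp \<Rightarrow> 'a set \<Rightarrow> 'a elp" where
  "add_facts P D \<equiv> elp_union P (facts (atoms P) D)"

lemma atoms_add_facts [simp]: "atoms (add_facts P D) = atoms P"
  and elits_add_facts [simp]: "elits (elp_union P (facts A D)) = elits P"
  by (auto simp: elp_union_def facts_def)

lemma add_facts_empty [simp]: "add_facts P {} = P"
  by (simp add: elp_union_def facts_def)

lemma reduct_sat_add_facts:
  "(\<forall>r \<in> rules (add_facts P D). reduct_sat \<Phi> M X r) \<longleftrightarrow>
    D \<subseteq> X \<and> (\<forall>r \<in> rules P. reduct_sat \<Phi> M X r)"
proof -
  have "reduct_sat \<Phi> M X \<lparr>head = {a}, body_lits = {}, body_epos = {}, body_eneg = {}\<rparr> \<longleftrightarrow> a \<in> X"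
    for a
    by (simp add: reduct_sat_def)
  then show ?thesis
    by (fastforce simp: elp_union_def facts_def)
qed

lemma answer_sets_add_facts:
  "answer_sets (epistemic_reduct (add_facts P D) \<Phi>) =
    {M. M \<subseteq> atoms P \<and> D \<subseteq> M \<and> (\<forall>r \<in> rules P. reduct_sat \<Phi> M M r) \<and>
      (\<forall>X. D \<subseteq> X \<and> X \<subset> M \<longrightarrow> (\<exists>r \<in> rules P. \<not> reduct_sat \<Phi> M X r))}"
  unfolding answer_sets_epistemic_reduct atoms_add_facts
proof (intro Collect_cong)
  fix M
  show "M \<subseteq> atoms P \<and> (\<forall>r \<in> rules (add_facts P D). reduct_sat \<Phi> M M r) \<and>
      (\<forall>X. X \<subset> M \<longrightarrow> (\<exists>r \<in> rules (add_facts P D). \<not> reduct_sat \<Phi> M X r)) \<longleftrightarrow>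
    M \<subseteq> atoms P \<and> D \<subseteq> M \<and> (\<forall>r \<in> rules P. reduct_sat \<Phi> M M r) \<and>
      (\<forall>X. D \<subseteq> X \<and> X \<subset> M \<longrightarrow> (\<exists>r \<in> rules P. \<not> reduct_sat \<Phi> M X r))"
    using reduct_sat_add_facts[of P D \<Phi> M] by meson
qed

text \<open>If no rule can fail above \<open>D\<close>, then \<open>D\<close> itself is a
  countermodel to the minimality of every larger candidate.\<close>

lemma answer_sets_add_facts_redundant_rules:
  assumes "D \<subseteq> atoms P"
    and "\<And>M X r. D \<subseteq> X \<Longrightarrow> X \<subseteq> M \<Longrightarrow> r \<in> rules P \<Longrightarrow> reduct_sat \<Phi> M X r"
  shows "answer_sets (epistemic_reduct (add_facts P D) \<Phi>) = {D}"
proof -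
  have "M \<subseteq> atoms P \<and> D \<subseteq> M \<and> (\<forall>r \<in> rules P. reduct_sat \<Phi> M M r) \<and>
      (\<forall>X. D \<subseteq> X \<and> X \<subset> M \<longrightarrow> (\<exists>r \<in> rules P. \<not> reduct_sat \<Phi> M X r)) \<longleftrightarrow> M = D" for M
  proof
    assume M: "M \<subseteq> atoms P \<and> D \<subseteq> M \<and> (\<forall>r \<in> rules P. reduct_sat \<Phi> M M r) \<and>
      (\<forall>X. D \<subseteq> X \<and> X \<subset> M \<longrightarrow> (\<exists>r \<in> rules P. \<not> reduct_sat \<Phi> M X r))"
    then have "\<not> D \<subset> M"
      using assms(2)[of D M] by blast
    then show "M = D"
      using M by blast
  next
    assume "M = D"
    then show "M \<subseteq> atoms P \<and> D \<subseteq> M \<and> (\<forall>r \<in> rules P. reduct_sat \<Phi> M M r) \<and>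
      (\<forall>X. D \<subseteq> X \<and> X \<subset> M \<longrightarrow> (\<exists>r \<in> rules P. \<not> reduct_sat \<Phi> M X r))"
      using assms by auto
  qed
  then show ?thesis
    unfolding answer_sets_add_facts by simp
qed

section \<open>World views and their guesses\<close>

text \<open>The two quantified clauses of compatibility are the two inclusions of this
  equation.\<close>

lemma cwv_guess_determined:
  assumes "cwv_guess P \<Phi> \<M>"
  shows "\<Phi> = {\<xi> \<in> elits P. \<exists>I \<in> \<M>. \<not> lit_sat I (elit_lit \<xi>)}"
  using assms by (auto simp: cwv_guess_def compatible_def)

lemma cwv_guess_iff:
  "cwv_guess P \<Phi> \<M> \<longleftrightarrow>
    \<M> \<in> CWV P \<and> \<Phi> = {\<xi> \<in> elits P. \<exists>I \<in> \<M>. \<not> lit_sat I (elit_lit \<xi>)}"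
  using cwv_guess_determined unfolding CWV_def by blast

text \<open>Maximality compares guesses, and these are computed from the CWVs and
  \<open>elits\<close> alone.\<close>

lemma WV_equivalent_if_CWV_equivalent:
  assumes "CWV_equivalent P Q" "elits P = elits Q"
  shows "WV_equivalent P Q"
  using assms unfolding CWV_equivalent_def WV_equivalent_def WV_def
  by (simp add: cwv_guess_iff)

lemma cwv_guess_cong:
  assumes "elits P = elits Q"
    and "\<And>\<Phi>. answer_sets (epistemic_reduct P \<Phi>) = answer_sets (epistemic_reduct Q \<Phi>)"
  shows "cwv_guess P = cwv_guess Q"
  using assms by (auto simp: cwv_guess_def fun_eq_iff)

lemma CWV_equivalent_if_same_answer_sets:
  assumes "elits P = elits Q"
    and "\<And>\<Phi>. answer_sets (epistemic_reduct P \<Phi>) = answer_sets (epistemic_reduct Q \<Phi>)"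
  shows "CWV_equivalent P Q"
  by (simp add: CWV_equivalent_def CWV_def cwv_guess_cong[OF assms])

text \<open>The full guess properly contains every other guess, so no other one can be
  maximal.\<close>

lemma WV_if_full_guess:
  assumes "cwv_guess P (elits P) \<M>"
  shows "WV P = {\<M>}"
proof -
  have max: "\<Phi> \<subseteq> elits P" if "cwv_guess P \<Phi> \<M>'" for \<Phi> \<M>'
    using that by (simp add: cwv_guess_def)
  have uniq: "\<M>' = \<M>" if "cwv_guess P (elits P) \<M>'" for \<M>'
    using that assms by (simp add: cwv_guess_def)
  have "\<M>' = \<M>" if WV: "\<M>' \<in> WV P" for \<M>'
  proof -
    obtain \<Phi> where \<Phi>: "cwv_guess P \<Phi> \<M>'" "\<not> \<Phi> \<subset> elits P"
      using WV assms unfolding WV_def by blast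
    then have "\<Phi> = elits P"
      using max by blast
    then show ?thesis
      using \<Phi>(1) uniq by simp
  qed
  moreover have "\<M> \<in> WV P"
    unfolding WV_def using assms max by blast
  ultimately show ?thesis
    by blast
qed

lemma CWV_no_elits:
  assumes "elits P = {}"
  shows "CWV P = {answer_sets (epistemic_reduct P {})} - {{}}"
  using assms by (auto simp: CWV_def cwv_guess_def compatible_def)

lemma WV_no_elits:
  assumes "elits P = {}"
  shows "WV P = CWV P"
proof -
  have "\<Phi> = {}" if "cwv_guess P \<Phi> \<M>" for \<Phi> \<M>
    using that assms by (simp add: cwv_guess_def)
  then show ?thesis
    unfolding WV_def CWV_def by blast
qed

section \<open>Implications between the notions of equivalence\<close>

definition rule_atoms :: "'a elp_rule \<Rightarrow> 'a set" where
  "rule_atoms r = head r \<union> lit_atom ` body_lits r \<union>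
    (\<lambda>\<xi>. lit_atom (elit_lit \<xi>)) ` (body_epos r \<union> body_eneg r)"

lemma finite_rule_atoms: "is_elp P \<Longrightarrow> finite (\<Union> (rule_atoms ` rules P))"
  by (auto simp: is_elp_def elp_rule_over_def rule_atoms_def)

lemma lit_sat_cong: "(lit_atom l \<in> I \<longleftrightarrow> lit_atom l \<in> J) \<Longrightarrow> lit_sat I l = lit_sat J l"
  by (cases l) auto

text \<open>A rule inspects \<open>M\<close>, \<open>X\<close> and the guess only at its own atoms.
  The guesses may differ on literals over atoms outside \<open>V\<close>, where adding facts can
  change what compatibility demands.\<close>

lemma reduct_sat_cong:
  assumes V: "rule_atoms r \<subseteq> V" and M: "M \<inter> V = M' \<inter> V" and X: "X \<inter> V = X' \<inter> V"
    and \<Phi>: "\<And>\<xi>. lit_atom (elit_lit \<xi>) \<in> V \<Longrightarrow> \<xi> \<in> \<Phi> \<longleftrightarrow> \<xi> \<in> \<Phi>'"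
  shows "reduct_sat \<Phi> M X r \<longleftrightarrow> reduct_sat \<Phi>' M' X' r"
proof -
  have pos: "a \<in> V" if "PosLit a \<in> body_lits r" for a
    using V that by (force simp: rule_atoms_def)
  have neg: "a \<in> V" if "NegLit a \<in> body_lits r" for a
    using V that by (force simp: rule_atoms_def)
  have el: "lit_atom (elit_lit \<xi>) \<in> V" if "\<xi> \<in> body_epos r \<union> body_eneg r" for \<xi>
    using V that by (force simp: rule_atoms_def)
  have el_sat: "lit_sat M (elit_lit \<xi>) = lit_sat M' (elit_lit \<xi>)"
    if "\<xi> \<in> body_epos r \<union> body_eneg r" for \<xi>
    using el[OF that] M by (intro lit_sat_cong) blast
  have "head r \<inter> X = head r \<inter> X'"
    using V X by (auto simp: rule_atoms_def)
  moreover have "(\<forall>a. PosLit a \<in> body_lits r \<longrightarrow> a \<in> X) \<longleftrightarrow> (\<forall>a. PosLit a \<in> body_lits r \<longrightarrow> a \<in> X')"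
    using pos X by blast
  moreover have "(\<forall>a. NegLit a \<in> body_lits r \<longrightarrow> a \<notin> M) \<longleftrightarrow> (\<forall>a. NegLit a \<in> body_lits r \<longrightarrow> a \<notin> M')"
    using neg M by blast
  moreover have "(\<forall>\<xi> \<in> body_epos r. \<xi> \<in> \<Phi> \<or> \<not> lit_sat M (elit_lit \<xi>)) \<longleftrightarrow>
      (\<forall>\<xi> \<in> body_epos r. \<xi> \<in> \<Phi>' \<or> \<not> lit_sat M' (elit_lit \<xi>))"
    using el el_sat \<Phi> by (intro ball_cong) auto
  moreover have "(\<forall>\<xi> \<in> body_eneg r. \<xi> \<notin> \<Phi> \<and> lit_sat M (elit_lit \<xi>)) \<longleftrightarrow>
      (\<forall>\<xi> \<in> body_eneg r. \<xi> \<notin> \<Phi>' \<and> lit_sat M' (elit_lit \<xi>))"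
    using el el_sat \<Phi> by (intro ball_cong) auto
  ultimately show ?thesis
    unfolding reduct_sat_def by simp
qed

text \<open>By minimality an atom outside \<open>V\<close> lies in an answer set only if it is a
  fact; the rules see nothing of it.\<close>

lemma answer_sets_restrict_facts:
  assumes V: "\<And>r. r \<in> rules P \<Longrightarrow> rule_atoms r \<subseteq> V" and D: "D \<subseteq> atoms P"
    and \<Phi>: "\<And>\<xi>. lit_atom (elit_lit \<xi>) \<in> V \<Longrightarrow> \<xi> \<in> \<Phi> \<longleftrightarrow> \<xi> \<in> \<Phi>'"
  shows "answer_sets (epistemic_reduct (add_facts P D) \<Phi>) =
    (\<lambda>I. I \<union> (D - V)) ` answer_sets (epistemic_reduct (add_facts P (D \<inter> V)) \<Phi>')" (is "?L = _ ` ?R")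
proof (intro set_eqI iffI)
  have cong: "reduct_sat \<Phi> M X r \<longleftrightarrow> reduct_sat \<Phi>' M' X' r"
    if "M \<inter> V = M' \<inter> V" "X \<inter> V = X' \<inter> V" "r \<in> rules P" for M M' X X' r
    using reduct_sat_cong[OF V[OF that(3)] that(1,2)] \<Phi> by blast
  fix M
  {
    assume "M \<in> ?L"
    then have sub: "M \<subseteq> atoms P" and DM: "D \<subseteq> M"
      and sat: "\<forall>r \<in> rules P. reduct_sat \<Phi> M M r"
      and min: "\<And>X. D \<subseteq> X \<Longrightarrow> X \<subset> M \<Longrightarrow> \<exists>r \<in> rules P. \<not> reduct_sat \<Phi> M X r"
      unfolding answer_sets_add_facts by blast+
    \<comment> \<open>Discarding from \<open>M\<close> all non-facts outside \<open>V\<close>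
      changes nothing on \<open>V\<close>, since \<open>D \<subseteq> M\<close>. Minimality then
      shows that nothing was discarded.\<close>
    have "reduct_sat \<Phi> M ((M \<inter> V) \<union> D) r" if "r \<in> rules P" for r
      using sat that cong[of M M "(M \<inter> V) \<union> D" M r] cong[of M M M M r] DM by blast
    then have M: "M = (M \<inter> V) \<union> (D - V)"
      using min[of "(M \<inter> V) \<union> D"] DM by blast
    \<comment> \<open>A smaller candidate for the restricted facts is lifted by adding back
      \<open>D - V\<close>.\<close>
    have "\<exists>r \<in> rules P. \<not> reduct_sat \<Phi>' (M \<inter> V) X r" if "D \<inter> V \<subseteq> X" "X \<subset> M \<inter> V" for X
    proof -
      have "D \<subseteq> X \<union> (D - V)" "X \<union> (D - V) \<subset> M"
        using that DM by blast+
      from min[OF this] obtain r where "r \<in> rules P" "\<not> reduct_sat \<Phi> M (X \<union> (D - V)) r"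
        by blast
      then show ?thesis
        using cong[of M "M \<inter> V" "X \<union> (D - V)" X r] by blast
    qed
    moreover have "\<forall>r \<in> rules P. reduct_sat \<Phi>' (M \<inter> V) (M \<inter> V) r"
      using sat cong[of M "M \<inter> V" M "M \<inter> V"] by blast
    ultimately have "M \<inter> V \<in> ?R"
      unfolding answer_sets_add_facts using sub DM by blast
    then show "M \<in> (\<lambda>I. I \<union> (D - V)) ` ?R"
      using M by blast
  next
    assume "M \<in> (\<lambda>I. I \<union> (D - V)) ` ?R"
    then obtain I where M: "M = I \<union> (D - V)" and "I \<in> ?R"
      by blast
    then have sub: "I \<subseteq> atoms P" and DI: "D \<inter> V \<subseteq> I"
      and sat: "\<forall>r \<in> rules P. reduct_sat \<Phi>' I I r"
      and min: "\<And>X. D \<inter> V \<subseteq> X \<Longrightarrow> X \<subset> I \<Longrightarrow> \<exists>r \<in> rules P. \<not> reduct_sat \<Phi>' I X r"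
      unfolding answer_sets_add_facts by blast+
    have "reduct_sat \<Phi>' I (I \<inter> V) r" if "r \<in> rules P" for r
      using sat that cong[of I I I "I \<inter> V" r] cong[of I I I I r] by blast
    then have IV: "I \<subseteq> V"
      using min[of "I \<inter> V"] DI by blast
    \<comment> \<open>An element of \<open>M\<close> missing from \<open>X\<close> is not in
      \<open>D\<close>, hence it lies in \<open>I \<subseteq> V\<close>; so
      \<open>X \<inter> V\<close> is still a proper subset of \<open>I\<close>.\<close>
    have "\<exists>r \<in> rules P. \<not> reduct_sat \<Phi> M X r" if "D \<subseteq> X" "X \<subset> M" for X
    proof -
      have "D \<inter> V \<subseteq> X \<inter> V" "X \<inter> V \<subset> I"
        using that M IV by blast+
      from min[OF this] obtain r where "r \<in> rules P" "\<not> reduct_sat \<Phi>' I (X \<inter> V) r"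
        by blast
      then show ?thesis
        using cong[of M I X "X \<inter> V" r] M by blast
    qed
    moreover have "\<forall>r \<in> rules P. reduct_sat \<Phi> M M r"
      using sat cong[of M I M I] M by blast
    ultimately show "M \<in> ?L"
      unfolding answer_sets_add_facts using sub D DI M by blast
  }
qed

text \<open>Intersecting \<open>I\<close> with \<open>V\<close> keeps all facts and the truth of
  every rule, so minimality forbids atoms outside \<open>V\<close>.\<close>

lemma answer_sets_subset_rule_atoms:
  assumes V: "\<And>r. r \<in> rules P \<Longrightarrow> rule_atoms r \<subseteq> V" and "D \<subseteq> V"
    and "I \<in> answer_sets (epistemic_reduct (add_facts P D) \<Phi>)"
  shows "I \<subseteq> V"
proof -
  have DI: "D \<subseteq> I" and sat: "\<And>r. r \<in> rules P \<Longrightarrow> reduct_sat \<Phi> I I r"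
    and min: "\<And>X. D \<subseteq> X \<Longrightarrow> X \<subset> I \<Longrightarrow> \<exists>r \<in> rules P. \<not> reduct_sat \<Phi> I X r"
    using assms(3) unfolding answer_sets_add_facts by blast+
  have "reduct_sat \<Phi> I (I \<inter> V) r" if "r \<in> rules P" for r
    using reduct_sat_cong[OF V[OF that], of I I "I \<inter> V" I \<Phi> \<Phi>] sat[OF that] by simp
  then have "\<not> I \<inter> V \<subset> I"
    using min[of "I \<inter> V"] DI assms(2) by blast
  then show ?thesis
    by blast
qed

text \<open>A CWV for \<open>D\<close> is cut down to one for \<open>D \<inter> V\<close>,
  transferred from \<open>P\<close> to \<open>Q\<close>, and extended again by \<open>D - V\<close>.
  The other inclusion follows by exchanging \<open>P\<close> and \<open>Q\<close>.\<close>

lemma CWV_subset_if_restricted_facts: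
  assumes pair: "atoms P = atoms Q" "elits P = elits Q"
    and V: "\<And>r. r \<in> rules P \<union> rules Q \<Longrightarrow> rule_atoms r \<subseteq> V" and D: "D \<subseteq> atoms P"
    and eq: "CWV_equivalent (add_facts P (D \<inter> V)) (add_facts Q (D \<inter> V))"
  shows "CWV (add_facts P D) \<subseteq> CWV (add_facts Q D)"
proof
  fix \<M>
  assume "\<M> \<in> CWV (add_facts P D)"
  then obtain \<Phi> where \<Phi>: "\<Phi> \<subseteq> elits P"
    and \<M>: "\<M> = answer_sets (epistemic_reduct (add_facts P D) \<Phi>)"
    and comp: "compatible \<Phi> (elits P) \<M>"
    by (auto simp: CWV_def cwv_guess_def)
  \<comment> \<open>Under the restricted facts, atoms outside \<open>V\<close> are false in every
    answer set. Compatibility therefore forces the guess there: a literal is guessed exactly if the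
    empty interpretation falsifies it.\<close>
  define \<Psi> where "\<Psi> = {\<xi> \<in> elits P.
    if lit_atom (elit_lit \<xi>) \<in> V then \<xi> \<in> \<Phi> else \<not> lit_sat {} (elit_lit \<xi>)}"
  define \<M>\<^sub>0 where "\<M>\<^sub>0 = answer_sets (epistemic_reduct (add_facts P (D \<inter> V)) \<Psi>)"
  have \<Psi>: "\<xi> \<in> \<Phi> \<longleftrightarrow> \<xi> \<in> \<Psi>" if "lit_atom (elit_lit \<xi>) \<in> V" for \<xi>
    using that \<Phi> by (auto simp: \<Psi>_def)
  have \<M>_eq: "\<M> = (\<lambda>I. I \<union> (D - V)) ` \<M>\<^sub>0"
    unfolding \<M> \<M>\<^sub>0_def using V D \<Psi> by (intro answer_sets_restrict_facts) blast+
  have sub: "I \<subseteq> V" if "I \<in> \<M>\<^sub>0" for I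
    using answer_sets_subset_rule_atoms[of P V "D \<inter> V" I \<Psi>] that V
    unfolding \<M>\<^sub>0_def by blast
  have inside: "lit_sat (I \<union> (D - V)) (elit_lit \<xi>) = lit_sat I (elit_lit \<xi>)"
    if "lit_atom (elit_lit \<xi>) \<in> V" for I \<xi>
    using that by (intro lit_sat_cong) blast
  have outside: "lit_sat I (elit_lit \<xi>) = lit_sat {} (elit_lit \<xi>)"
    if "lit_atom (elit_lit \<xi>) \<notin> V" "I \<in> \<M>\<^sub>0" for I \<xi>
    using that sub[of I] by (intro lit_sat_cong) blast
  have "compatible \<Psi> (elits P) \<M>\<^sub>0"
    unfolding compatible_def
  proof (intro conjI ballI)
    show ne: "\<M>\<^sub>0 \<noteq> {}"
      using comp by (auto simp: compatible_def \<M>_eq)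
    fix \<xi>
    {
      assume \<xi>: "\<xi> \<in> \<Psi>"
      show "\<exists>I \<in> \<M>\<^sub>0. \<not> lit_sat I (elit_lit \<xi>)"
      proof (cases "lit_atom (elit_lit \<xi>) \<in> V")
        case True
        then show ?thesis
          using \<xi> comp \<Psi>[of \<xi>] by (auto simp: compatible_def \<M>_eq inside)
      next
        case False
        then show ?thesis
          using \<xi> ne outside[of \<xi>] by (auto simp: \<Psi>_def)
      qed
    next
      fix I
      assume \<xi>: "\<xi> \<in> elits P - \<Psi>" and I: "I \<in> \<M>\<^sub>0"
      show "lit_sat I (elit_lit \<xi>)"
      proof (cases "lit_atom (elit_lit \<xi>) \<in> V")
        case True
        then have "lit_sat (I \<union> (D - V)) (elit_lit \<xi>)"
          using \<xi> I comp \<Psi>[of \<xi>] by (auto simp: compatible_def \<M>_eq)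
        then show ?thesis
          using inside[OF True] by simp
      next
        case False
        then show ?thesis
          using \<xi> I outside[of \<xi>] by (auto simp: \<Psi>_def)
      qed
    }
  qed
  then have "cwv_guess (add_facts P (D \<inter> V)) \<Psi> \<M>\<^sub>0"
    by (auto simp: cwv_guess_def \<M>\<^sub>0_def \<Psi>_def)
  \<comment> \<open>CWV-equivalence shares only the view, but the view determines its guess, so
    \<open>Q\<close> obtains it with the same \<Psi>.\<close>
  then have "cwv_guess (add_facts Q (D \<inter> V)) \<Psi> \<M>\<^sub>0"
    using eq pair by (simp add: cwv_guess_iff CWV_equivalent_def)
  then have "\<M>\<^sub>0 = answer_sets (epistemic_reduct (add_facts Q (D \<inter> V)) \<Psi>)"
    by (simp add: cwv_guess_def)
  moreover have "answer_sets (epistemic_reduct (add_facts Q D) \<Phi>) =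
      (\<lambda>I. I \<union> (D - V)) ` answer_sets (epistemic_reduct (add_facts Q (D \<inter> V)) \<Psi>)"
    using V D \<Psi> pair by (intro answer_sets_restrict_facts) auto
  ultimately have "\<M> = answer_sets (epistemic_reduct (add_facts Q D) \<Phi>)"
    using \<M>_eq by simp
  then have "cwv_guess (add_facts Q D) \<Phi> \<M>"
    using \<Phi> comp pair by (simp add: cwv_guess_def)
  then show "\<M> \<in> CWV (add_facts Q D)"
    by (auto simp: CWV_def)
qed

lemma is_elp_facts: "finite D \<Longrightarrow> D \<subseteq> A \<Longrightarrow> is_elp (facts A D)"
  by (auto simp: is_elp_def facts_def elp_rule_over_def)

lemma uniformly_CWV_equivalent_if_strongly_equivalent:
  assumes pair: "elp_pair P Q" and strong: "strongly_equivalent P Q"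
  shows "uniformly_CWV_equivalent P Q"
  unfolding uniformly_CWV_equivalent_def
proof (intro allI impI)
  fix D
  assume D: "D \<subseteq> atoms P"
  define V where "V = \<Union> (rule_atoms ` (rules P \<union> rules Q))"
  have at: "atoms P = atoms Q" and el: "elits P = elits Q"
    using pair by (auto simp: elp_pair_def)
  have "finite V"
    using pair finite_rule_atoms[of P] finite_rule_atoms[of Q]
    by (simp add: V_def elp_pair_def image_Un)
  then have "is_elp (facts (atoms P) (D \<inter> V))"
    using D by (intro is_elp_facts) auto
  then have eq: "CWV_equivalent (add_facts P (D \<inter> V)) (add_facts Q (D \<inter> V))"
    using strong at by (simp add: strongly_equivalent_def)
  have V: "rule_atoms r \<subseteq> V" if "r \<in> rules P \<union> rules Q" for r
    using that by (auto simp: V_def)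
  have "CWV (add_facts P D) \<subseteq> CWV (add_facts Q D)"
    using CWV_subset_if_restricted_facts[OF at el V D eq] by blast
  moreover have "CWV (add_facts Q D) \<subseteq> CWV (add_facts P D)"
    using CWV_subset_if_restricted_facts[of Q P V D] at el V D eq
    by (auto simp: CWV_equivalent_def)
  ultimately show
    "CWV_equivalent (elp_union P (facts (atoms P) D)) (elp_union Q (facts (atoms P) D))"
    using at by (simp add: CWV_equivalent_def)
qed

section \<open>The remaining implications\<close>

lemma uniformly_WV_equivalent_if_uniformly_CWV_equivalent:
  assumes "elp_pair P Q" "uniformly_CWV_equivalent P Q"
  shows "uniformly_WV_equivalent P Q"
  unfolding uniformly_WV_equivalent_def
proof (intro allI impI)
  fix D
  assume "D \<subseteq> atoms P"
  then show "WV_equivalent (elp_union P (facts (atoms P) D)) (elp_union Q (facts (atoms P) D))"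
    using assms
    by (intro WV_equivalent_if_CWV_equivalent)
      (simp_all add: uniformly_CWV_equivalent_def elp_pair_def)
qed

lemma CWV_equivalent_if_uniformly_CWV_equivalent:
  assumes "elp_pair P Q" "uniformly_CWV_equivalent P Q"
  shows "CWV_equivalent P Q"
  using assms add_facts_empty
  by (metis uniformly_CWV_equivalent_def elp_pair_def empty_subsetI)

lemma WV_equivalent_if_uniformly_WV_equivalent:
  assumes "elp_pair P Q" "uniformly_WV_equivalent P Q"
  shows "WV_equivalent P Q"
  using assms add_facts_empty
  by (metis uniformly_WV_equivalent_def elp_pair_def empty_subsetI)

lemma strictly_strongerI:
  assumes "\<And>P Q. elp_pair P Q \<Longrightarrow> S P Q \<Longrightarrow> T P Q" "elp_pair P Q" "T P Q" "\<not> S P Q"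
  shows "strictly_stronger S T"
  using assms unfolding strictly_stronger_def by blast

section \<open>Separating examples\<close>

text \<open>\<open>E\<close> is kept apart from the body \<open>B\<close> so that the guarded and
  the unguarded disjunction can share the same \<open>elits\<close>, as \<open>elp_pair\<close>
  requires.\<close>

definition disj_prog :: "'a \<Rightarrow> 'a \<Rightarrow> 'a epistemic_literal set \<Rightarrow> 'a epistemic_literal set \<Rightarrow> 'a elp" where
  "disj_prog a b E B = \<lparr>atoms = {a, b}, elits = E,
    rules = {\<lparr>head = {a, b}, body_lits = {}, body_epos = B, body_eneg = {}\<rparr>}\<rparr>"

definition choice :: "'a \<Rightarrow> 'a \<Rightarrow> 'a elp" where
  "choice a b = \<lparr>atoms = {a, b}, elits = {}, rules = {
    \<lparr>head = {a}, body_lits = {NegLit b}, body_epos = {}, body_eneg = {}\<rparr>,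
    \<lparr>head = {b}, body_lits = {NegLit a}, body_epos = {}, body_eneg = {}\<rparr>}\<rparr>"

definition loop :: "'a \<Rightarrow> 'a \<Rightarrow> 'a elp" where
  "loop a b = \<lparr>atoms = {a, b}, elits = {}, rules = {
    \<lparr>head = {a}, body_lits = {PosLit b}, body_epos = {}, body_eneg = {}\<rparr>,
    \<lparr>head = {b}, body_lits = {PosLit a}, body_epos = {}, body_eneg = {}\<rparr>}\<rparr>"

definition no_rules :: "'a \<Rightarrow> 'a elp" where
  "no_rules a = \<lparr>atoms = {a}, elits = {}, rules = {}\<rparr>"

definition forbid :: "'a \<Rightarrow> 'a elp" where
  "forbid a = \<lparr>atoms = {a}, elits = {},
    rules = {\<lparr>head = {}, body_lits = {PosLit a}, body_epos = {}, body_eneg = {}\<rparr>}\<rparr>"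

text \<open>Any fact from the head satisfies the disjunction, whatever the guess makes of its
  body.\<close>

lemma answer_sets_disj_add_facts:
  assumes "D \<subseteq> {a, b}" "D \<noteq> {}"
  shows "answer_sets (epistemic_reduct (add_facts (disj_prog a b E B) D) \<Phi>) = {D}"
  using assms
  by (intro answer_sets_add_facts_redundant_rules) (auto simp: disj_prog_def reduct_sat_def)

text \<open>A fact satisfies the rule with that head and, being in \<open>M\<close>, blocks the body
  of the other rule.\<close>

lemma answer_sets_choice_add_facts:
  assumes "D \<subseteq> {a, b}" "D \<noteq> {}"
  shows "answer_sets (epistemic_reduct (add_facts (choice a b) D) \<Phi>) = {D}"
proof -
  have "a \<in> D \<or> b \<in> D"
    using assms by auto
  then show ?thesis
    using assms(1)
    by (intro answer_sets_add_facts_redundant_rules) (auto simp: choice_def reduct_sat_def)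
qed

section \<open>Enumerating answer sets over two atoms\<close>

lemma subset_doubleton_cases:
  "M \<subseteq> {a, b} \<longleftrightarrow> M = {} \<or> M = {a} \<or> M = {b} \<or> M = {a, b}"
  by auto

lemma psubset_singleton: "X \<subset> {a} \<longleftrightarrow> X = {}"
  by auto

lemma psubset_doubleton:
  "a \<noteq> b \<Longrightarrow> X \<subset> {a, b} \<longleftrightarrow> X = {} \<or> X = {a} \<or> X = {b}"
  by auto

text \<open>Lists the four candidates with their proper subsets, so that concrete programs need only
  finitely many checks of \<open>reduct_sat\<close>.\<close>

lemma answer_sets_two_atoms:
  assumes "a \<noteq> b" "atoms P = {a, b}"
  shows "answer_sets (epistemic_reduct P \<Phi>) =
    {M. M = {} \<and> (\<forall>r \<in> rules P. reduct_sat \<Phi> {} {} r)} \<union>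
    {M. \<exists>c \<in> {a, b}. M = {c} \<and> (\<forall>r \<in> rules P. reduct_sat \<Phi> {c} {c} r) \<and>
      (\<exists>r \<in> rules P. \<not> reduct_sat \<Phi> {c} {} r)} \<union>
    {M. M = {a, b} \<and> (\<forall>r \<in> rules P. reduct_sat \<Phi> {a, b} {a, b} r) \<and>
      (\<forall>X \<in> {{}, {a}, {b}}. \<exists>r \<in> rules P. \<not> reduct_sat \<Phi> {a, b} X r)}"
proof -
  define K where "K M \<longleftrightarrow> (\<forall>r \<in> rules P. reduct_sat \<Phi> M M r) \<and>
    (\<forall>X. X \<subset> M \<longrightarrow> (\<exists>r \<in> rules P. \<not> reduct_sat \<Phi> M X r))" for M
  have K0: "(\<forall>r \<in> rules P. reduct_sat \<Phi> {} {} r) \<longleftrightarrow> K {}"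
    by (simp add: K_def)
  have K1: "(\<forall>r \<in> rules P. reduct_sat \<Phi> {c} {c} r) \<and>
      (\<exists>r \<in> rules P. \<not> reduct_sat \<Phi> {c} {} r) \<longleftrightarrow> K {c}" for c
    by (simp add: K_def psubset_singleton)
  have K2: "(\<forall>r \<in> rules P. reduct_sat \<Phi> {a, b} {a, b} r) \<and>
      (\<forall>X \<in> {{}, {a}, {b}}. \<exists>r \<in> rules P. \<not> reduct_sat \<Phi> {a, b} X r) \<longleftrightarrow> K {a, b}"
    by (simp add: K_def psubset_doubleton[OF assms(1)] all_conj_distrib imp_disjL)
  have "answer_sets (epistemic_reduct P \<Phi>) = {M. M \<subseteq> {a, b} \<and> K M}"
    by (simp add: answer_sets_epistemic_reduct assms(2) K_def)
  then show ?thesis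
    unfolding K0 K1 K2 subset_doubleton_cases by auto
qed

text \<open>With \<open>B\<close> guessed, the whole body reduces to \<open>Top\<close> and a plain
  disjunction remains.\<close>

lemma answer_sets_disj:
  assumes "a \<noteq> b" "B \<subseteq> \<Phi>"
  shows "answer_sets (epistemic_reduct (disj_prog a b E B) \<Phi>) = {{a}, {b}}"
proof -
  have at: "atoms (disj_prog a b E B) = {a, b}"
    by (simp add: disj_prog_def)
  show ?thesis
    unfolding answer_sets_two_atoms[OF assms(1) at] using assms
    by (auto simp: disj_prog_def reduct_sat_def)
qed

lemma answer_sets_choice:
  assumes "a \<noteq> b"
  shows "answer_sets (epistemic_reduct (choice a b) \<Phi>) = {{a}, {b}}"
proof -
  have at: "atoms (choice a b) = {a, b}"
    by (simp add: choice_def)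
  show ?thesis
    unfolding answer_sets_two_atoms[OF assms(1) at] using assms
    by (auto simp: choice_def reduct_sat_def)
qed

section \<open>Strictness witnessed by two-atom programs\<close>

lemma strong_strictly_stronger_than_uniform_CWV:
  assumes "(a :: 'a) \<noteq> b"
  shows "strictly_stronger (strongly_equivalent :: 'a elp \<Rightarrow> 'a elp \<Rightarrow> bool)
    uniformly_CWV_equivalent"
proof -
  let ?P = "disj_prog a b {} {}" and ?Q = "choice a b" and ?R = "loop a b"
  have pair: "elp_pair ?P ?Q"
    by (auto simp: elp_pair_def is_elp_def elp_rule_over_def disj_prog_def choice_def)
  have at: "atoms ?P = {a, b}" "atoms ?Q = {a, b}"
    by (simp_all add: disj_prog_def choice_def)
  have "CWV_equivalent (add_facts ?P D) (add_facts ?Q D)" if "D \<subseteq> {a, b}" for D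
  proof (rule CWV_equivalent_if_same_answer_sets)
    show "elits (add_facts ?P D) = elits (add_facts ?Q D)"
      using pair by (simp add: elp_pair_def)
    show "answer_sets (epistemic_reduct (add_facts ?P D) \<Phi>) =
        answer_sets (epistemic_reduct (add_facts ?Q D) \<Phi>)" for \<Phi>
      using that
      by (cases "D = {}") (simp_all add: answer_sets_disj_add_facts answer_sets_choice_add_facts
          answer_sets_disj[OF assms] answer_sets_choice[OF assms])
  qed
  then have uniform: "uniformly_CWV_equivalent ?P ?Q"
    by (simp add: uniformly_CWV_equivalent_def at)
  have R: "is_elp ?R"
    by (auto simp: is_elp_def elp_rule_over_def loop_def)
  have at_union: "atoms (elp_union ?P ?R) = {a, b}" "atoms (elp_union ?Q ?R) = {a, b}"
    by (auto simp: elp_union_def disj_prog_def choice_def loop_def)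
  have elits_union: "elits (elp_union ?P ?R) = {}" "elits (elp_union ?Q ?R) = {}"
    by (auto simp: elp_union_def disj_prog_def choice_def loop_def)
  have "answer_sets (epistemic_reduct (elp_union ?P ?R) {}) = {{a, b}}"
    unfolding answer_sets_two_atoms[OF assms at_union(1)] using assms
    by (auto simp: elp_union_def disj_prog_def loop_def reduct_sat_def)
  \<comment> \<open>The loop rules exclude both singletons, and the empty set triggers the choice
    rules. For \<open>{a, b}\<close> the GL-reduct drops both choice rules, leaving the empty set as
    a smaller model.\<close>
  moreover have "answer_sets (epistemic_reduct (elp_union ?Q ?R) {}) = {}"
    unfolding answer_sets_two_atoms[OF assms at_union(2)] using assms
    by (auto simp: elp_union_def choice_def loop_def reduct_sat_def)
  ultimately have "\<not> CWV_equivalent (elp_union ?P ?R) (elp_union ?Q ?R)"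
    by (simp add: CWV_equivalent_def CWV_no_elits elits_union)
  then have separated: "\<not> strongly_equivalent ?P ?Q"
    using R by (auto simp: strongly_equivalent_def)
  show ?thesis
    by (rule strictly_strongerI[OF _ pair])
      (fact uniformly_CWV_equivalent_if_strongly_equivalent uniform separated)+
qed

lemma uniform_CWV_strictly_stronger_than_uniform_WV:
  assumes "(a :: 'a) \<noteq> b"
  shows "strictly_stronger (uniformly_CWV_equivalent :: 'a elp \<Rightarrow> 'a elp \<Rightarrow> bool)
    uniformly_WV_equivalent"
proof -
  \<comment> \<open>Negative literals make two guesses viable: the views \<open>{a}\<close> and
    \<open>{b}\<close> together falsify both literals, while the empty interpretation satisfies
    both.\<close>
  define E where "E = {ENot (NegLit a), ENot (NegLit b)}"
  let ?P = "disj_prog a b E E" and ?Q = "disj_prog a b E {}"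
  have pair: "elp_pair ?P ?Q"
    by (auto simp: elp_pair_def is_elp_def elp_rule_over_def disj_prog_def E_def)
  have at: "atoms ?P = {a, b}" "atoms ?Q = {a, b}" and el: "elits ?P = E" "elits ?Q = E"
    by (simp_all add: disj_prog_def)
  have full: "cwv_guess (disj_prog a b E B) E {{a}, {b}}" if "B \<subseteq> E" for B
    unfolding cwv_guess_def answer_sets_disj[OF assms that]
    by (auto simp: disj_prog_def compatible_def E_def)
  have "WV ?P = {{{a}, {b}}}" "WV ?Q = {{{a}, {b}}}"
    using WV_if_full_guess[of ?P] WV_if_full_guess[of ?Q] full[of E] full[of "{}"] el by auto
  then have WV: "WV_equivalent ?P ?Q"
    by (simp add: WV_equivalent_def)
  have "WV_equivalent (add_facts ?P D) (add_facts ?Q D)" if "D \<subseteq> {a, b}" for D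
  proof (cases "D = {}")
    case True
    then show ?thesis
      using WV by simp
  next
    case False
    then have "CWV_equivalent (add_facts ?P D) (add_facts ?Q D)"
      using that by (intro CWV_equivalent_if_same_answer_sets)
        (simp_all add: answer_sets_disj_add_facts el)
    then show ?thesis
      by (rule WV_equivalent_if_CWV_equivalent) (simp add: el)
  qed
  then have uniform: "uniformly_WV_equivalent ?P ?Q"
    by (simp add: uniformly_WV_equivalent_def at)
  \<comment> \<open>Under the empty guess the body is the double negation of both atoms. It fails
    for the empty set and the singletons; for \<open>{a, b}\<close> it holds, but the remaining
    disjunction has smaller models.\<close>
  have "answer_sets (epistemic_reduct ?P {}) = {{}}"
    unfolding answer_sets_two_atoms[OF assms at(1)] using assms
    by (auto simp: disj_prog_def E_def reduct_sat_def)
  then have "cwv_guess ?P {} {{}}"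
    by (simp add: cwv_guess_def compatible_def el) (simp add: E_def)
  then have "{{}} \<in> CWV ?P"
    by (auto simp: CWV_def)
  moreover have "{{}} \<notin> CWV ?Q"
    using answer_sets_disj[OF assms] by (auto simp: CWV_def cwv_guess_def)
  ultimately have "\<not> CWV_equivalent ?P ?Q"
    by (auto simp: CWV_equivalent_def)
  \<comment> \<open>The programs already differ without added facts.\<close>
  then have separated: "\<not> uniformly_CWV_equivalent ?P ?Q"
    using pair CWV_equivalent_if_uniformly_CWV_equivalent by blast
  show ?thesis
    by (rule strictly_strongerI[OF _ pair])
      (fact uniformly_WV_equivalent_if_uniformly_CWV_equivalent uniform separated)+
qed

section \<open>Strictness witnessed by a constraint on one atom\<close>

lemma no_rules_forbid_pair: "elp_pair (no_rules a) (forbid a)"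
  by (auto simp: elp_pair_def is_elp_def elp_rule_over_def no_rules_def forbid_def)

text \<open>Without facts \<open>a\<close> is underivable, so the empty set is the only answer set
  of both programs and the constraint never applies.\<close>

lemma no_rules_forbid_CWV_equivalent: "CWV_equivalent (no_rules a) (forbid a)"
proof (rule CWV_equivalent_if_same_answer_sets)
  show "answer_sets (epistemic_reduct (no_rules a) \<Phi>) =
      answer_sets (epistemic_reduct (forbid a) \<Phi>)" for \<Phi>
    unfolding answer_sets_epistemic_reduct
    by (auto simp: no_rules_def forbid_def reduct_sat_def subset_singleton_iff)
qed (simp add: no_rules_def forbid_def)

text \<open>The fact \<open>a\<close> violates the constraint, leaving \<open>forbid a\<close>
  without answer sets and hence without CWVs.\<close>

lemma no_rules_forbid_separated:
  "CWV (add_facts (no_rules a) {a}) \<noteq> CWV (add_facts (forbid a) {a})"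
proof -
  have el: "elits (no_rules a) = {}" "elits (forbid a) = {}"
    by (simp_all add: no_rules_def forbid_def)
  have "answer_sets (epistemic_reduct (add_facts (no_rules a) {a}) {}) = {{a}}"
    by (rule answer_sets_add_facts_redundant_rules) (auto simp: no_rules_def)
  moreover have "answer_sets (epistemic_reduct (add_facts (forbid a) {a}) {}) = {}"
    unfolding answer_sets_add_facts by (auto simp: forbid_def reduct_sat_def)
  ultimately show ?thesis
    by (simp add: CWV_no_elits el)
qed

lemma uniform_CWV_strictly_stronger_than_CWV:
  "strictly_stronger (uniformly_CWV_equivalent :: 'a elp \<Rightarrow> 'a elp \<Rightarrow> bool) CWV_equivalent"
proof -
  fix a :: 'a
  have at: "atoms (no_rules a) = {a}" "atoms (forbid a) = {a}"
    by (simp_all add: no_rules_def forbid_def)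
  have separated: "\<not> uniformly_CWV_equivalent (no_rules a) (forbid a)"
    using no_rules_forbid_separated[of a] at
    by (auto simp: uniformly_CWV_equivalent_def CWV_equivalent_def)
  show ?thesis
    by (rule strictly_strongerI[OF _ no_rules_forbid_pair[of a]])
      (fact CWV_equivalent_if_uniformly_CWV_equivalent no_rules_forbid_CWV_equivalent separated)+
qed

lemma uniform_WV_strictly_stronger_than_WV:
  "strictly_stronger (uniformly_WV_equivalent :: 'a elp \<Rightarrow> 'a elp \<Rightarrow> bool) WV_equivalent"
proof -
  fix a :: 'a
  have at: "atoms (no_rules a) = {a}" "atoms (forbid a) = {a}"
    and el: "elits (no_rules a) = {}" "elits (forbid a) = {}"
    by (simp_all add: no_rules_def forbid_def)
  \<comment> \<open>Without epistemic literals there is a single possible guess, so WVs and CWVs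
    coincide and the CWV separation carries over.\<close>
  have "WV (add_facts (no_rules a) {a}) \<noteq> WV (add_facts (forbid a) {a})"
    using no_rules_forbid_separated by (simp add: WV_no_elits el)
  then have separated: "\<not> uniformly_WV_equivalent (no_rules a) (forbid a)"
    using at by (auto simp: uniformly_WV_equivalent_def WV_equivalent_def)
  have equiv: "WV_equivalent (no_rules a) (forbid a)"
    using WV_equivalent_if_CWV_equivalent[OF no_rules_forbid_CWV_equivalent[of a]] el by simp
  show ?thesis
    by (rule strictly_strongerI[OF _ no_rules_forbid_pair[of a]])
      (fact WV_equivalent_if_uniformly_WV_equivalent equiv separated)+
qed

theorem theorem3:
  assumes "infinite (UNIV :: 'a set)"
  shows "strictly_stronger (strongly_equivalent :: 'a elp \<Rightarrow> 'a elp \<Rightarrow> bool) uniformly_CWV_equivalent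
    \<and> strictly_stronger (uniformly_CWV_equivalent :: 'a elp \<Rightarrow> 'a elp \<Rightarrow> bool) uniformly_WV_equivalent
    \<and> strictly_stronger (uniformly_CWV_equivalent :: 'a elp \<Rightarrow> 'a elp \<Rightarrow> bool) CWV_equivalent
    \<and> strictly_stronger (uniformly_WV_equivalent :: 'a elp \<Rightarrow> 'a elp \<Rightarrow> bool) WV_equivalent"
proof -
  obtain a b :: 'a where "a \<noteq> b"
    using assms by (metis (full_types) UNIV_eq_I finite.emptyI finite_insert singletonI)
  then show ?thesis
    by (intro conjI strong_strictly_stronger_than_uniform_CWV
        uniform_CWV_strictly_stronger_than_uniform_WV
        uniform_CWV_strictly_stronger_than_CWV uniform_WV_strictly_stronger_than_WV)
qed

end
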